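(* Let $n\ge 2$ be a natural number, and suppose that the Lonely Runner Conjecture holds for $n-1$ runners, i.e., $\mathrm{ML}(w_1,\ldots,w_{n-1})\ge 1/n$ for all nonzero real numbers $w_1,\ldots,w_{n-1}$. Let $v_1,\ldots,v_n$ be nonzero integers with $\gcd(v_1,\ldots,v_n)=1$ and $$\sqrt{v_1^2+\cdots+v_n^2} > \frac{\Gamma((n+1)/2)\,(n(n+1))^{n-1}}{\pi^{(n-1)/2}}.$$ Then $\mathrm{ML}(v_1,\ldots,v_n)\ge 1/(n+1)$. Moreover, the threshold on the right-hand side is smaller than $n^{(5/2)n}$.
   Context: For nonzero real numbers $v_1,\ldots,v_m$, the maximum loneliness is $$\mathrm{ML}(v_1,\ldots,v_m)=\sup_{t\in\mathbb{R}}\min_{1\le i\le m}\|tv_i\|_{\mathbb{R}/\mathbb{Z}},$$ where $\|x\|_{\mathbb{R}/\mathbb{Z}}$ denotes the distance from $x$ to the nearest integer. $\Gamma$ is the Gamma function. *)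

theory Defs
  imports "HOL-Analysis.Analysis"
begin

definition dist_nearest_int :: "real \<Rightarrow> real"
  where "dist_nearest_int x = \<bar>x - of_int (round x)\<bar>"

lemma dist_nearest_int_eq_infdist: "dist_nearest_int x = infdist x \<int>"
proof (rule antisym)
  have ne: "(\<int> :: real set) \<noteq> {}"
    using Ints_0 by blast
  show "infdist x \<int> \<le> dist_nearest_int x"
    unfolding dist_nearest_int_def dist_real_def[symmetric]
    by (rule infdist_le) simp
  show "dist_nearest_int x \<le> infdist x \<int>"
    unfolding infdist_notempty[OF ne]
  proof (rule cINF_greatest[OF ne])
    fix y :: real assume "y \<in> \<int>"
    then obtain k where "y = of_int k" by (elim Ints_cases)
    then show "dist_nearest_int x \<le> dist x y"
      using round_diff_minimal[of x k] by (simp add: dist_nearest_int_def dist_real_def)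
  qed
qed

lemma dist_nearest_int_le_half: "dist_nearest_int x \<le> 1 / 2"
  using of_int_round_abs_le[of x] by (simp add: dist_nearest_int_def abs_minus_commute)

text \<open>Only the values \<open>v 1, \<dots>, v m\<close> matter. For \<open>m = 0\<close> the value is unspecified.\<close>

definition max_loneliness :: "nat \<Rightarrow> (nat \<Rightarrow> real) \<Rightarrow> real"
  where "max_loneliness m v =
    (SUP t::real. Min ((\<lambda>i. dist_nearest_int (t * v i)) ` {1..m}))"

lemma bdd_above_loneliness:
  fixes v :: "nat \<Rightarrow> real"
  assumes "m \<ge> 1"
  shows "bdd_above (range (\<lambda>t::real. Min ((\<lambda>i. dist_nearest_int (t * v i)) ` {1..m})))"
proof (rule bdd_aboveI2)
  fix t :: real
  have "Min ((\<lambda>i. dist_nearest_int (t * v i)) ` {1..m}) \<le> dist_nearest_int (t * v 1)"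
    using assms by (intro Min_le imageI finite_imageI) simp_all
  also have "\<dots> \<le> 1 / 2" by (rule dist_nearest_int_le_half)
  finally show "Min ((\<lambda>i. dist_nearest_int (t * v i)) ` {1..m}) \<le> 1 / 2" .
qed

end

theory Submission
  imports Defs
begin

text \<open>
The trajectory \<open>\<real>v\<close> of the runners winds around the torus \<open>\<real>\<^sup>n / \<int>\<^sup>n\<close>. When \<open>v\<close> is long it has to come back close
to itself: the tube of radius \<open>r = 1 / (n (n + 1))\<close> around one period of it has volume
\<open>\<bar>v\<bar> \<cdot> vol B\<^sup>n\<^sup>-\<^sup>1(r)\<close>, and the lower bound on \<open>\<bar>v\<bar>\<close> says exactly that this exceeds 1, the volume of the
torus. By Blichfeldt's principle (\<open>blichfeldt\<close>) two points of the tube differ by an integer vector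
\<open>w\<close>, so \<open>w = s v + u\<close> with \<open>\<bar>u\<bar> \<le> 2 r\<close>; primitivity of \<open>v\<close> ensures \<open>u \<noteq> 0\<close> (\<open>close_lattice_point\<close>).

Modulo \<open>\<int>\<^sup>n\<close>, adding \<open>u\<close> is the same as moving along the trajectory by \<open>- s\<close>. Hence every translate of
\<open>\<real>v\<close> by a multiple of \<open>u\<close> lies on the trajectory, which therefore comes within \<open>\<bar>u\<bar> / 2 \<le> r\<close> of every
point of the plane spanned by \<open>u\<close> and \<open>v\<close> (\<open>winding_line_approximates\<close>).

That plane contains a velocity vector with nonzero entries two of which agree up to sign
(\<open>plane_equal_speeds\<close>). Such a vector describes essentially \<open>n - 1\<close> runners, so by hypothesis its
loneliness is at least \<open>1 / n\<close>, up to an arbitrarily small error. Following it along the original trajectory costs at most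
\<open>r = 1 / n - 1 / (n + 1)\<close>, which leaves \<open>1 / (n + 1)\<close> (\<open>loneliness_of_long_velocity\<close>).

Since the dimension is a number and not a type, Lebesgue measure on \<open>\<real>\<^sup>n\<close> is the product measure over a
finite index set, and linear changes of variables are done one coordinate at a time. The tube is cut
off by hyperplanes where one coordinate is constant instead of by hyperplanes orthogonal to \<open>v\<close>; then
its volume follows from a determinant for a rank-one perturbation of the Euclidean form
(\<open>nn_integral_leb_rank_one\<close>, \<open>emeasure_tube\<close>) and no rotation is needed.
\<close>

section \<open>Lebesgue measure on finite powers of the line\<close>

abbreviation leb :: "'a set \<Rightarrow> ('a \<Rightarrow> real) measure"
  where "leb A \<equiv> PiM A (\<lambda>_. lborel)"

interpretation leb: product_sigma_finite "\<lambda>_::'a. lborel :: real measure"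
  by standard

lemma nn_integral_leb_translate:
  assumes "finite A" and "F \<in> borel_measurable (leb A)"
  shows "(\<integral>\<^sup>+x. F (\<lambda>i\<in>A. x i + c i) \<partial>leb A) = (\<integral>\<^sup>+x. F x \<partial>leb A)"
  using assms
proof (induction A arbitrary: F rule: finite_induct)
  case empty
  show ?case by (intro nn_integral_cong) (auto simp: space_PiM)
next
  case (insert k A)
  note [measurable] = insert.prems
  have meas: "(\<lambda>x. F (\<lambda>i\<in>insert k A. x i + c i)) \<in> borel_measurable (leb (insert k A))"
    by measurable
  have "(\<integral>\<^sup>+x. F (\<lambda>i\<in>insert k A. x i + c i) \<partial>leb (insert k A))
      = (\<integral>\<^sup>+x. \<integral>\<^sup>+y. F (\<lambda>i\<in>insert k A. (x(k := y)) i + c i) \<partial>lborel \<partial>leb A)"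
    by (rule leb.product_nn_integral_insert[OF insert.hyps meas])
  also have "\<dots> = (\<integral>\<^sup>+x. \<integral>\<^sup>+y. F ((\<lambda>i\<in>A. x i + c i)(k := y)) \<partial>lborel \<partial>leb A)"
  proof (rule nn_integral_cong)
    fix x assume "x \<in> space (leb A)"
    have x': "(\<lambda>i\<in>A. x i + c i) \<in> space (leb A)" by (simp add: space_PiM)
    have m: "(\<lambda>y. F ((\<lambda>i\<in>A. x i + c i)(k := y))) \<in> borel_measurable borel"
      using measurable_comp[OF measurable_component_update[OF x' insert.hyps(2)] insert.prems]
      by (simp add: o_def cong: measurable_cong_sets)
    have eq: "(\<lambda>i\<in>insert k A. (x(k := y)) i + c i) = (\<lambda>i\<in>A. x i + c i)(k := c k + 1 * y)" for y
      using insert.hyps by (auto simp: fun_eq_iff restrict_def)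
    show "(\<integral>\<^sup>+y. F (\<lambda>i\<in>insert k A. (x(k := y)) i + c i) \<partial>lborel)
        = (\<integral>\<^sup>+y. F ((\<lambda>i\<in>A. x i + c i)(k := y)) \<partial>lborel)"
      unfolding eq using nn_integral_real_affine[OF m, of 1 "c k"] by simp
  qed
  also have "\<dots> = (\<integral>\<^sup>+x. \<integral>\<^sup>+y. F (x(k := y)) \<partial>lborel \<partial>leb A)"
    by (rule insert.IH) measurable
  also have "\<dots> = (\<integral>\<^sup>+x. F x \<partial>leb (insert k A))"
    by (rule leb.product_nn_integral_insert[OF insert.hyps insert.prems, symmetric])
  finally show ?case .
qed

text \<open>
If no two points of \<open>S\<close> were congruent, cutting \<open>S\<close> along the integer grid and moving all pieces into the
unit cube would give disjoint pieces of total measure at most 1.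
\<close>

theorem blichfeldt:
  fixes S :: "('a \<Rightarrow> real) set"
  assumes A: "finite A" and S[measurable]: "S \<in> sets (leb A)" and big: "emeasure (leb A) S > 1"
  obtains x y and w :: "'a \<Rightarrow> int"
  where "x \<in> S" "y \<in> S" "x \<noteq> y" "\<And>i. i \<in> A \<Longrightarrow> x i - y i = of_int (w i)"
proof (rule ccontr)
  note witness = that
  assume contr: "\<not> thesis"
  have uniq: "x = y" if "x \<in> S" "y \<in> S" "\<And>i. i \<in> A \<Longrightarrow> x i - y i = of_int (w i)"
    for x y and w :: "'a \<Rightarrow> int"
    using witness[OF that(1,2) _ that(3)] contr by blast
  define M where "M = PiE A (\<lambda>_. UNIV :: int set)"
  have M: "countable M" unfolding M_def using A by (intro countable_PiE) auto
  \<comment> \<open>The piece of \<open>S\<close> in the grid cell at \<open>m\<close>, and the same piece moved to the unit cube.\<close>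
  define T where "T m = {x \<in> space (leb A). x \<in> S \<and> (\<forall>i\<in>A. \<lfloor>x i\<rfloor> = m i)}" for m
  define U where "U m = {x \<in> space (leb A). (\<lambda>i\<in>A. x i + of_int (m i)) \<in> S \<and> (\<forall>i\<in>A. \<lfloor>x i\<rfloor> = 0)}"
    for m :: "'a \<Rightarrow> int"
  have [measurable]: "T m \<in> sets (leb A)" for m
    unfolding T_def using A by measurable
  have [measurable]: "U m \<in> sets (leb A)" for m
    unfolding U_def using A by measurable
  have Ssp: "S \<subseteq> space (leb A)" using S by (rule sets.sets_into_space)
  have ST: "S = (\<Union>m\<in>M. T m)"
  proof
    show "S \<subseteq> (\<Union>m\<in>M. T m)"
    proof
      fix x assume "x \<in> S"
      then have "x \<in> T (\<lambda>i\<in>A. \<lfloor>x i\<rfloor>)" using Ssp by (auto simp: T_def)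
      moreover have "(\<lambda>i\<in>A. \<lfloor>x i\<rfloor>) \<in> M" by (simp add: M_def)
      ultimately show "x \<in> (\<Union>m\<in>M. T m)" by blast
    qed
  qed (auto simp: T_def)
  have Mext: "m = m'" if "m \<in> M" "m' \<in> M" "\<And>i. i \<in> A \<Longrightarrow> m i = m' i" for m m'
    using that unfolding M_def by (intro PiE_ext[of m A _ m']) auto
  have dT: "disjoint_family_on T M"
    unfolding disjoint_family_on_def T_def by (auto dest: Mext)
  have dU: "disjoint_family_on U M"
    unfolding disjoint_family_on_def
  proof (intro ballI impI)
    fix m m' assume m: "m \<in> M" "m' \<in> M" "m \<noteq> m'"
    show "U m \<inter> U m' = {}"
    proof (rule ccontr)
      assume "U m \<inter> U m' \<noteq> {}"
      then obtain x where "(\<lambda>i\<in>A. x i + of_int (m i)) \<in> S" "(\<lambda>i\<in>A. x i + of_int (m' i)) \<in> S"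
        by (auto simp: U_def)
      then have "(\<lambda>i\<in>A. x i + of_int (m i)) = (\<lambda>i\<in>A. x i + of_int (m' i))"
        by (rule uniq[where w = "\<lambda>i. m i - m' i"]) simp
      then have "m i = m' i" if "i \<in> A" for i
        using that by (auto simp: fun_eq_iff restrict_def dest: spec[of _ i])
      with m Mext show False by blast
    qed
  qed
  have TU: "emeasure (leb A) (T m) = emeasure (leb A) (U m)" for m
  proof -
    have "emeasure (leb A) (T m) = (\<integral>\<^sup>+x. indicator (T m) x \<partial>leb A)" by simp
    also have "\<dots> = (\<integral>\<^sup>+x. indicator (T m) (\<lambda>i\<in>A. x i + of_int (m i)) \<partial>leb A)"
      by (rule nn_integral_leb_translate[symmetric]) (use A in measurable)
    also have "\<dots> = (\<integral>\<^sup>+x. indicator (U m) x \<partial>leb A)"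
      by (intro nn_integral_cong) (auto simp: indicator_def T_def U_def space_PiM)
    finally show ?thesis by simp
  qed
  have "emeasure (leb A) S = (\<integral>\<^sup>+m. emeasure (leb A) (T m) \<partial>count_space M)"
    unfolding ST by (rule emeasure_UN_countable[OF _ M dT]) measurable
  also have "\<dots> = emeasure (leb A) (\<Union>m\<in>M. U m)"
    unfolding TU by (rule emeasure_UN_countable[OF _ M dU, symmetric]) measurable
  also have "\<dots> \<le> emeasure (leb A) (PiE A (\<lambda>_. {0..<1}))"
  proof (rule emeasure_mono)
    show "(\<Union>m\<in>M. U m) \<subseteq> PiE A (\<lambda>_. {0..<1})"
      by (auto simp: U_def space_PiM PiE_iff floor_eq_iff extensional_def)
  qed (use A in \<open>auto intro!: sets_PiM_I_finite\<close>)
  also have "\<dots> = 1"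
    using A by (subst leb.emeasure_PiM) auto
  finally show False using big by simp
qed

text \<open>
This is the change of variables that diagonalises the form \<open>\<bar>x\<bar>\<^sup>2 - \<langle>a, x\<rangle>\<^sup>2\<close>, of determinant \<open>1 - \<bar>a\<bar>\<^sup>2\<close>.
Completing the square in one coordinate (a shear and a scaling) leaves a form of the same shape, in
one variable less and with a rescaled \<open>a\<close>. Having an arbitrary \<open>f\<close> makes the induction go
through, because the completed square can be absorbed into \<open>f\<close>.
\<close>

lemma nn_integral_leb_rank_one:
  fixes a :: "'a \<Rightarrow> real" and f :: "real \<Rightarrow> ennreal"
  assumes "finite A" and "f \<in> borel_measurable borel" and "(\<Sum>i\<in>A. (a i)\<^sup>2) < 1"
  shows "(\<integral>\<^sup>+x. f ((\<Sum>i\<in>A. (x i)\<^sup>2) - (\<Sum>i\<in>A. a i * x i)\<^sup>2) \<partial>leb A)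
       = ennreal (1 / sqrt (1 - (\<Sum>i\<in>A. (a i)\<^sup>2))) * (\<integral>\<^sup>+x. f (\<Sum>i\<in>A. (x i)\<^sup>2) \<partial>leb A)"
  using assms
proof (induction A arbitrary: a f rule: finite_induct)
  case empty
  show ?case by simp
next
  case (insert k A)
  note [measurable] = insert.prems(1)
  interpret A: finite_product_sigma_finite "\<lambda>_::'a. lborel :: real measure" A
    by standard (rule insert.hyps)
  define b where "b = 1 - (a k)\<^sup>2"
  have sum0: "(\<Sum>i\<in>A. (a i)\<^sup>2) \<ge> 0" by (intro sum_nonneg) auto
  have lt: "(a k)\<^sup>2 + (\<Sum>i\<in>A. (a i)\<^sup>2) < 1" using insert by simp
  have b: "b > 0" using lt sum0 by (simp add: b_def)
  define a' where "a' i = a i / sqrt b" for i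
  have sa': "(\<Sum>i\<in>A. (a' i)\<^sup>2) = (\<Sum>i\<in>A. (a i)\<^sup>2) / b"
    using b by (simp add: a'_def power_divide sum_divide_distrib)
  have a'1: "(\<Sum>i\<in>A. (a' i)\<^sup>2) < 1" using lt b by (simp add: sa' b_def)
  have upd: "(\<Sum>i\<in>A. g i ((x(k := y)) i)) = (\<Sum>i\<in>A. g i (x i))" for g :: "'a \<Rightarrow> real \<Rightarrow> real" and x y
    using insert.hyps by (intro sum.cong) auto
  define F where "F x = f ((x k)\<^sup>2 + ((\<Sum>i\<in>A. (x i)\<^sup>2) - (\<Sum>i\<in>A. a' i * x i)\<^sup>2))" for x
  have F[measurable]: "F \<in> borel_measurable (leb (insert k A))"
    unfolding F_def by measurable
  have F_upd: "F (x(k := z)) = f (z\<^sup>2 + ((\<Sum>i\<in>A. (x i)\<^sup>2) - (\<Sum>i\<in>A. a' i * x i)\<^sup>2))" for x z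
    unfolding F_def upd[of "\<lambda>_ t. t\<^sup>2"] upd[of "\<lambda>i t. a' i * t"] fun_upd_same ..
  have "(\<integral>\<^sup>+x. f ((\<Sum>i\<in>insert k A. (x i)\<^sup>2) - (\<Sum>i\<in>insert k A. a i * x i)\<^sup>2) \<partial>leb (insert k A))
      = (\<integral>\<^sup>+x. \<integral>\<^sup>+y. f (y\<^sup>2 + (\<Sum>i\<in>A. (x i)\<^sup>2) - (a k * y + (\<Sum>i\<in>A. a i * x i))\<^sup>2) \<partial>lborel \<partial>leb A)"
    using insert.hyps upd[of "\<lambda>_ t. t\<^sup>2"] upd[of "\<lambda>i t. a i * t"]
    by (subst leb.product_nn_integral_insert) (auto simp del: fun_upd_apply simp: fun_upd_same)
  also have "\<dots> = (\<integral>\<^sup>+x. ennreal (1 / sqrt b) * (\<integral>\<^sup>+z. F (x(k := z)) \<partial>lborel) \<partial>leb A)"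
  proof (rule nn_integral_cong)
    fix x :: "'a \<Rightarrow> real"
    define L where "L = (\<Sum>i\<in>A. a i * x i)"
    define s where "s = (\<Sum>i\<in>A. (x i)\<^sup>2)"
    have sq: "(sqrt b)\<^sup>2 = b" using b by simp
    have L': "(\<Sum>i\<in>A. a' i * x i) = L / sqrt b"
      by (simp add: L_def a'_def sum_divide_distrib)
    have id: "(a k * L / b + 1 / sqrt b * z)\<^sup>2 + s - (a k * (a k * L / b + 1 / sqrt b * z) + L)\<^sup>2
        = z\<^sup>2 + (s - (L / sqrt b)\<^sup>2)" for z
    proof -
      define q where "q = 1 / sqrt b"
      define p where "p = q * q"
      have p: "p * b = 1" "p = 1 / b" using b by (auto simp: p_def q_def)
      have "(a k * L * p + q * z)\<^sup>2 + s - (a k * (a k * L * p + q * z) + L)\<^sup>2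
          = b * (a k * L * p + q * z)\<^sup>2 - 2 * a k * L * (a k * L * p + q * z) - L\<^sup>2 + s"
        unfolding b_def by (simp add: power2_eq_square algebra_simps)
      also have "\<dots> = (p * b) * (a k)\<^sup>2 * L\<^sup>2 * p + 2 * (p * b) * a k * L * q * z + (p * b) * z\<^sup>2
          - 2 * (a k)\<^sup>2 * L\<^sup>2 * p - 2 * a k * L * q * z - L\<^sup>2 + s"
        unfolding p_def by (simp add: power2_eq_square algebra_simps)
      also have "\<dots> = z\<^sup>2 + s - L\<^sup>2 * (1 + (a k)\<^sup>2 * p)"
        unfolding p(1) by (simp add: algebra_simps)
      also have "1 + (a k)\<^sup>2 * p = p"
        using p(1) by (simp add: b_def algebra_simps)
      finally show ?thesis
        using sq by (simp add: p(2) q_def power_divide)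
    qed
    have "(\<integral>\<^sup>+y. f (y\<^sup>2 + s - (a k * y + L)\<^sup>2) \<partial>lborel)
        = ennreal \<bar>1 / sqrt b\<bar> * (\<integral>\<^sup>+z. f ((a k * L / b + 1 / sqrt b * z)\<^sup>2 + s
             - (a k * (a k * L / b + 1 / sqrt b * z) + L)\<^sup>2) \<partial>lborel)"
      using b by (intro nn_integral_real_affine) auto
    also have "\<dots> = ennreal (1 / sqrt b) * (\<integral>\<^sup>+z. F (x(k := z)) \<partial>lborel)"
      unfolding id unfolding F_upd L' s_def using b by simp
    finally show "(\<integral>\<^sup>+y. f (y\<^sup>2 + (\<Sum>i\<in>A. (x i)\<^sup>2) - (a k * y + (\<Sum>i\<in>A. a i * x i))\<^sup>2) \<partial>lborel)
        = ennreal (1 / sqrt b) * (\<integral>\<^sup>+z. F (x(k := z)) \<partial>lborel)"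
      by (simp add: L_def s_def)
  qed
  also have "\<dots> = ennreal (1 / sqrt b) * (\<integral>\<^sup>+x. \<integral>\<^sup>+z. F (x(k := z)) \<partial>lborel \<partial>leb A)"
    by (rule nn_integral_cmult) measurable
  also have "(\<integral>\<^sup>+x. \<integral>\<^sup>+z. F (x(k := z)) \<partial>lborel \<partial>leb A) = (\<integral>\<^sup>+z. \<integral>\<^sup>+x. F (x(k := z)) \<partial>leb A \<partial>lborel)"
    using leb.product_nn_integral_insert[OF insert.hyps F] leb.product_nn_integral_insert_rev[OF insert.hyps F]
    by simp
  also have "\<dots> = (\<integral>\<^sup>+z. ennreal (1 / sqrt (1 - (\<Sum>i\<in>A. (a' i)\<^sup>2))) *
      (\<integral>\<^sup>+x. f (z\<^sup>2 + (\<Sum>i\<in>A. (x i)\<^sup>2)) \<partial>leb A) \<partial>lborel)"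
    unfolding F_upd
    by (intro nn_integral_cong insert.IH a'1) measurable
  also have "\<dots> = ennreal (1 / sqrt (1 - (\<Sum>i\<in>A. (a' i)\<^sup>2))) *
      (\<integral>\<^sup>+z. \<integral>\<^sup>+x. f (z\<^sup>2 + (\<Sum>i\<in>A. (x i)\<^sup>2)) \<partial>leb A \<partial>lborel)"
    by (rule nn_integral_cmult) measurable
  also have "(\<integral>\<^sup>+z. \<integral>\<^sup>+x. f (z\<^sup>2 + (\<Sum>i\<in>A. (x i)\<^sup>2)) \<partial>leb A \<partial>lborel)
      = (\<integral>\<^sup>+x. f (\<Sum>i\<in>insert k A. (x i)\<^sup>2) \<partial>leb (insert k A))"
    using insert.hyps upd[of "\<lambda>_ t. t\<^sup>2"]
    by (subst leb.product_nn_integral_insert_rev) (auto simp del: fun_upd_apply simp: fun_upd_same)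
  finally have "(\<integral>\<^sup>+x. f ((\<Sum>i\<in>insert k A. (x i)\<^sup>2) - (\<Sum>i\<in>insert k A. a i * x i)\<^sup>2) \<partial>leb (insert k A))
     = (ennreal (1 / sqrt b) * ennreal (1 / sqrt (1 - (\<Sum>i\<in>A. (a' i)\<^sup>2)))) *
        (\<integral>\<^sup>+x. f (\<Sum>i\<in>insert k A. (x i)\<^sup>2) \<partial>leb (insert k A))"
    by (simp only: mult.assoc)
  also have "ennreal (1 / sqrt b) * ennreal (1 / sqrt (1 - (\<Sum>i\<in>A. (a' i)\<^sup>2)))
      = ennreal (1 / sqrt (1 - (\<Sum>i\<in>insert k A. (a i)\<^sup>2)))"
  proof -
    have "b * (1 - (\<Sum>i\<in>A. (a' i)\<^sup>2)) = 1 - (\<Sum>i\<in>insert k A. (a i)\<^sup>2)"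
      using b insert.hyps by (simp add: sa' b_def field_simps)
    then have "1 / sqrt b * (1 / sqrt (1 - (\<Sum>i\<in>A. (a' i)\<^sup>2))) = 1 / sqrt (1 - (\<Sum>i\<in>insert k A. (a i)\<^sup>2))"
      by (simp flip: real_sqrt_mult)
    then show ?thesis using b by (simp flip: ennreal_mult')
  qed
  finally show ?case .
qed

section \<open>The volume of a tube around a line\<close>

text \<open>The length of the component of \<open>x\<close> orthogonal to \<open>v\<close>, that is, the distance from \<open>x\<close> to \<open>\<real>v\<close>.\<close>

definition line_dist :: "('a \<Rightarrow> real) \<Rightarrow> 'a set \<Rightarrow> ('a \<Rightarrow> real) \<Rightarrow> real"
  where "line_dist v I x = L2_set (\<lambda>i. x i - (\<Sum>j\<in>I. v j * x j) / (\<Sum>j\<in>I. (v j)\<^sup>2) * v i) I"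

lemma line_dist_cong:
  assumes "\<And>i. i \<in> I \<Longrightarrow> x i = y i"
  shows "line_dist v I x = line_dist v I y"
  unfolding line_dist_def using assms by (intro L2_set_cong) (auto cong: sum.cong)

lemma line_dist_diff_le: "line_dist v I (\<lambda>i. x i - y i) \<le> line_dist v I x + line_dist v I y"
proof -
  have "line_dist v I (\<lambda>i. x i - y i) = L2_set (\<lambda>i.
      (x i - (\<Sum>j\<in>I. v j * x j) / (\<Sum>j\<in>I. (v j)\<^sup>2) * v i) +
      - (y i - (\<Sum>j\<in>I. v j * y j) / (\<Sum>j\<in>I. (v j)\<^sup>2) * v i)) I"
    unfolding line_dist_def
    by (intro L2_set_cong) (simp_all add: sum_subtractf algebra_simps diff_divide_distrib)
  also have "\<dots> \<le> line_dist v I x + L2_set (\<lambda>i. - (y i - (\<Sum>j\<in>I. v j * y j) / (\<Sum>j\<in>I. (v j)\<^sup>2) * v i)) I"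
    unfolding line_dist_def by (rule L2_set_triangle_ineq)
  also have "L2_set (\<lambda>i. - (y i - (\<Sum>j\<in>I. v j * y j) / (\<Sum>j\<in>I. (v j)\<^sup>2) * v i)) I = line_dist v I y"
    unfolding line_dist_def L2_set_def by (simp add: power2_commute)
  finally show ?thesis .
qed

lemma line_dist_shift:
  assumes "(\<Sum>j\<in>I. (v j)\<^sup>2) \<noteq> 0"
  shows "line_dist v I (\<lambda>i. x i + s * v i) = line_dist v I x"
proof -
  have "(\<Sum>j\<in>I. v j * (x j + s * v j)) = (\<Sum>j\<in>I. v j * x j) + s * (\<Sum>j\<in>I. (v j)\<^sup>2)"
    by (simp add: algebra_simps sum.distrib sum_distrib_left power2_eq_square)
  with assms show ?thesis
    unfolding line_dist_def by (intro L2_set_cong) (simp_all add: field_simps)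
qed

lemma line_dist_sq:
  assumes "(\<Sum>j\<in>I. (v j)\<^sup>2) \<noteq> 0"
  shows "(line_dist v I x)\<^sup>2 = (\<Sum>i\<in>I. (x i)\<^sup>2) - (\<Sum>i\<in>I. v i / sqrt (\<Sum>j\<in>I. (v j)\<^sup>2) * x i)\<^sup>2"
proof -
  define N where "N = (\<Sum>j\<in>I. (v j)\<^sup>2)"
  define p where "p = (\<Sum>i\<in>I. v i * x i)"
  have N: "N > 0" using assms sum_nonneg[of I "\<lambda>j. (v j)\<^sup>2"] unfolding N_def by simp
  have "(line_dist v I x)\<^sup>2 = (\<Sum>i\<in>I. (x i - p / N * v i)\<^sup>2)"
    unfolding line_dist_def L2_set_def p_def N_def by (intro real_sqrt_pow2 sum_nonneg) auto
  also have "\<dots> = (\<Sum>i\<in>I. (x i)\<^sup>2 - 2 * (p / N) * (v i * x i) + (p / N)\<^sup>2 * (v i)\<^sup>2)"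
    by (intro sum.cong) (simp_all add: power2_eq_square algebra_simps)
  also have "\<dots> = (\<Sum>i\<in>I. (x i)\<^sup>2) - 2 * (p / N) * p + (p / N)\<^sup>2 * N"
    unfolding sum.distrib sum_subtractf sum_distrib_left[symmetric] p_def[symmetric] N_def[symmetric] ..
  also have "\<dots> = (\<Sum>i\<in>I. (x i)\<^sup>2) - p\<^sup>2 / N"
    using N by (simp add: power2_eq_square field_simps)
  also have "p\<^sup>2 / N = (\<Sum>i\<in>I. v i / sqrt N * x i)\<^sup>2"
    using N by (simp add: p_def power_divide sum_divide_distrib[symmetric])
  finally show ?thesis by (simp add: N_def)
qed

text \<open>
One period \<open>v\<close> of the tube around \<open>\<real>v\<close>. A multiple \<open>c v\<close> that is the difference of two points of it
has \<open>\<bar>c\<bar> < 1\<close>.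
\<close>

definition tube :: "('a \<Rightarrow> real) \<Rightarrow> 'a set \<Rightarrow> 'a \<Rightarrow> real \<Rightarrow> ('a \<Rightarrow> real) set"
  where "tube v I k r = {x \<in> space (leb I). 0 \<le> x k / v k \<and> x k / v k < 1 \<and> line_dist v I x \<le> r}"

lemma sets_tube [measurable]:
  assumes "finite I" "k \<in> I"
  shows "tube v I k r \<in> sets (leb I)"
  unfolding tube_def line_dist_def L2_set_def using assms by measurable

text \<open>
Sliding along \<open>v\<close> turns every slice \<open>x k = const\<close> of the tube into its slice \<open>x k = 0\<close>. That slice is the
ellipsoid \<open>\<bar>x\<bar>\<^sup>2 - \<langle>a, x\<rangle>\<^sup>2 \<le> r\<^sup>2\<close> with \<open>a = v / \<bar>v\<bar>\<close> and \<open>1 - \<bar>a\<bar>\<^sup>2 = (v k)\<^sup>2 / \<bar>v\<bar>\<^sup>2\<close>, so its volume is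
\<open>\<bar>v\<bar> / \<bar>v k\<bar>\<close> times that of the ball; the slices range over an interval of length \<open>\<bar>v k\<bar>\<close>.
\<close>

lemma emeasure_tube:
  fixes v :: "'a \<Rightarrow> real"
  assumes A: "finite A" "k \<notin> A" and vk: "v k \<noteq> 0" and r: "r > 0"
  shows "emeasure (leb (insert k A)) (tube v (insert k A) k r)
    = ennreal (sqrt (\<Sum>i\<in>insert k A. (v i)\<^sup>2) * (unit_ball_vol (card A) * r ^ card A))"
proof -
  let ?I = "insert k A"
  interpret A: finite_product_sigma_finite "\<lambda>_::'a. lborel :: real measure" A
    by standard fact
  define N where "N = (\<Sum>i\<in>?I. (v i)\<^sup>2)"
  define a where "a i = v i / sqrt N" for i
  have "(\<Sum>i\<in>A. (v i)\<^sup>2) \<ge> 0" by (intro sum_nonneg) auto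
  then have N: "N > 0" using A vk by (simp add: N_def add_pos_nonneg)
  have N0: "(\<Sum>i\<in>?I. (v i)\<^sup>2) \<noteq> 0" using N by (simp add: N_def)
  have a1: "1 - (\<Sum>i\<in>A. (a i)\<^sup>2) = (v k)\<^sup>2 / N"
  proof -
    have "(\<Sum>i\<in>A. (a i)\<^sup>2) = (\<Sum>i\<in>A. (v i)\<^sup>2) / N"
      using N by (simp add: a_def power_divide sum_divide_distrib)
    moreover have "(\<Sum>i\<in>A. (v i)\<^sup>2) = N - (v k)\<^sup>2" using A by (simp add: N_def)
    ultimately show ?thesis using N by (simp add: field_simps)
  qed
  moreover have "(v k)\<^sup>2 / N > 0" using vk N by simp
  ultimately have a_lt: "(\<Sum>i\<in>A. (a i)\<^sup>2) < 1" by linarith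
  have r': "1 / sqrt (1 - (\<Sum>i\<in>A. (a i)\<^sup>2)) = sqrt N / \<bar>v k\<bar>"
    unfolding a1 by (simp add: real_sqrt_divide)
  have upd: "(\<Sum>i\<in>A. g i ((x(k := y)) i)) = (\<Sum>i\<in>A. g i (x i))" for g :: "'a \<Rightarrow> real \<Rightarrow> real" and x y
    using A by (intro sum.cong) auto
  have slice0: "(line_dist v ?I (x(k := 0)))\<^sup>2 = (\<Sum>i\<in>A. (x i)\<^sup>2) - (\<Sum>i\<in>A. a i * x i)\<^sup>2" for x
    unfolding line_dist_sq[OF N0] N_def[symmetric] a_def[symmetric]
    using A upd[of "\<lambda>_ t. t\<^sup>2"] upd[of "\<lambda>i t. a i * t"] by (simp del: fun_upd_apply add: fun_upd_same)
  have nonneg: "line_dist v ?I x \<ge> 0" for x by (simp add: line_dist_def)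
  have iff: "line_dist v ?I x \<le> r \<longleftrightarrow> (line_dist v ?I x)\<^sup>2 \<le> r\<^sup>2" for x
    using r nonneg[of x] by (simp add: abs_le_square_iff[symmetric])
  define F :: "('a \<Rightarrow> real) \<Rightarrow> ennreal" where
    "F x = indicator {..r\<^sup>2} ((\<Sum>i\<in>A. (x i)\<^sup>2) - (\<Sum>i\<in>A. a i * x i)\<^sup>2)" for x
  have [measurable]: "F \<in> borel_measurable (leb A)" unfolding F_def by measurable
  have slice: "indicator (tube v ?I k r) (x(k := y))
      = (indicator {0..<1} (y / v k) :: ennreal) * F (\<lambda>i\<in>A. x i + - (y / v k * v i))"
    if x: "x \<in> space (leb A)" for x y
  proof -
    have sp: "x(k := y) \<in> space (leb ?I)"
      using x by (auto simp: space_PiM PiE_iff extensional_def)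
    have "line_dist v ?I (x(k := y)) = line_dist v ?I (\<lambda>i. (x(k := y)) i + - (y / v k) * v i)"
      by (rule line_dist_shift[OF N0, symmetric])
    also have "\<dots> = line_dist v ?I ((\<lambda>i\<in>A. x i + - (y / v k * v i))(k := 0))"
      using A vk by (intro line_dist_cong) auto
    finally show ?thesis
      using sp by (simp add: tube_def F_def indicator_def iff slice0 del: fun_upd_apply add: fun_upd_same)
  qed
  have "emeasure (leb ?I) (tube v ?I k r) = (\<integral>\<^sup>+x. indicator (tube v ?I k r) x \<partial>leb ?I)"
    using A by simp
  also have "\<dots> = (\<integral>\<^sup>+y. \<integral>\<^sup>+x. indicator (tube v ?I k r) (x(k := y)) \<partial>leb A \<partial>lborel)"
    using A by (intro leb.product_nn_integral_insert_rev) auto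
  also have "\<dots> = (\<integral>\<^sup>+y. indicator {0..<1} (y / v k) * (\<integral>\<^sup>+x. F x \<partial>leb A) \<partial>lborel)"
  proof (rule nn_integral_cong)
    fix y :: real
    have "(\<integral>\<^sup>+x. indicator (tube v ?I k r) (x(k := y)) \<partial>leb A)
       = (\<integral>\<^sup>+x. indicator {0..<1} (y / v k) * F (\<lambda>i\<in>A. x i + - (y / v k * v i)) \<partial>leb A)"
      by (intro nn_integral_cong slice)
    also have "\<dots> = indicator {0..<1} (y / v k) * (\<integral>\<^sup>+x. F (\<lambda>i\<in>A. x i + - (y / v k * v i)) \<partial>leb A)"
      by (rule nn_integral_cmult) measurable
    also have "(\<integral>\<^sup>+x. F (\<lambda>i\<in>A. x i + - (y / v k * v i)) \<partial>leb A) = (\<integral>\<^sup>+x. F x \<partial>leb A)"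
      using A by (intro nn_integral_leb_translate) auto
    finally show "(\<integral>\<^sup>+x. indicator (tube v ?I k r) (x(k := y)) \<partial>leb A)
       = indicator {0..<1} (y / v k) * (\<integral>\<^sup>+x. F x \<partial>leb A)" .
  qed
  also have "\<dots> = (\<integral>\<^sup>+y. indicator {0..<1} (y / v k) \<partial>lborel) * (\<integral>\<^sup>+x. F x \<partial>leb A)"
    by (rule nn_integral_multc) measurable
  also have "(\<integral>\<^sup>+y. indicator {0..<1} (y / v k) \<partial>lborel)
      = ennreal \<bar>v k\<bar> * (\<integral>\<^sup>+y. indicator {0..<1::real} ((0 + v k * y) / v k) \<partial>lborel)"
    using vk by (intro nn_integral_real_affine) auto
  also have "(\<integral>\<^sup>+y. indicator {0..<1::real} ((0 + v k * y) / v k) \<partial>lborel) = (1::ennreal)"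
    using vk by simp
  also have "(\<integral>\<^sup>+x. F x \<partial>leb A) = ennreal (sqrt N / \<bar>v k\<bar>) * (\<integral>\<^sup>+x. indicator {..r\<^sup>2} (\<Sum>i\<in>A. (x i)\<^sup>2) \<partial>leb A)"
    unfolding F_def r'[symmetric] using a_lt A by (intro nn_integral_leb_rank_one) auto
  also have "(\<integral>\<^sup>+x. indicator {..r\<^sup>2} (\<Sum>i\<in>A. (x i)\<^sup>2) \<partial>leb A)
      = (\<integral>\<^sup>+x. indicator ({f. sqrt (\<Sum>i\<in>A. (f i)\<^sup>2) \<le> r} \<inter> space (leb A)) x \<partial>leb A)"
    using r by (intro nn_integral_cong) (auto simp: indicator_def real_sqrt_le_iff' sum_nonneg)
  also have "\<dots> = emeasure (leb A) ({f. sqrt (\<Sum>i\<in>A. (f i)\<^sup>2) \<le> r} \<inter> space (leb A))"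
    using A by (intro nn_integral_indicator) measurable
  also have "\<dots> = ennreal (unit_ball_vol (card A) * r ^ card A)"
    by (rule emeasure_cball_aux[OF A(1) r])
  finally have "emeasure (leb ?I) (tube v ?I k r)
     = ennreal \<bar>v k\<bar> * (ennreal (sqrt N / \<bar>v k\<bar>) * ennreal (unit_ball_vol (card A) * r ^ card A))"
    by simp
  also have "\<dots> = ennreal (\<bar>v k\<bar> * (sqrt N / \<bar>v k\<bar> * (unit_ball_vol (card A) * r ^ card A)))"
    using N r by (subst ennreal_mult'[symmetric], simp)+ simp
  also have "\<bar>v k\<bar> * (sqrt N / \<bar>v k\<bar> * (unit_ball_vol (card A) * r ^ card A))
      = sqrt N * (unit_ball_vol (card A) * r ^ card A)"
    using vk by simp
  finally show ?thesis by (simp add: N_def)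
qed

section \<open>Near returns of a long trajectory\<close>

text \<open>
Cross-multiplying gives \<open>w k * v i = v k * w i\<close>, so \<open>v k\<close> divides \<open>w k * Gcd (v ` I) = w k\<close>, which is
smaller than \<open>v k\<close> in absolute value.
\<close>

lemma primitive_multiple:
  fixes v w :: "'a \<Rightarrow> int"
  assumes "Gcd (v ` I) = 1" "k \<in> I" "v k \<noteq> 0"
    and w: "\<And>i. i \<in> I \<Longrightarrow> of_int (w i) = (s :: real) * of_int (v i)" and s: "\<bar>s\<bar> < 1"
  shows "s = 0"
proof -
  have cross: "w k * v i = v k * w i" if "i \<in> I" for i
  proof -
    have "real_of_int (w k * v i) = real_of_int (v k * w i)" using w that assms(2) by simp
    then show ?thesis by linarith
  qed
  have "v k dvd Gcd ((*) (w k) ` v ` I)"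
    by (rule Gcd_greatest) (auto simp: cross)
  then have "v k dvd w k" using assms(1) by (simp add: Gcd_mult)
  moreover have "\<bar>w k\<bar> < \<bar>v k\<bar>"
  proof -
    have "real_of_int \<bar>w k\<bar> = \<bar>s\<bar> * real_of_int \<bar>v k\<bar>" using w assms(2) by (simp add: abs_mult)
    also have "\<dots> < 1 * real_of_int \<bar>v k\<bar>" using s assms(3) by (intro mult_strict_right_mono) auto
    finally show ?thesis by linarith
  qed
  ultimately have "w k = 0" using dvd_imp_le_int by (metis linorder_not_less)
  with w[of k] assms(2,3) show ?thesis by simp
qed

lemma close_lattice_point:
  fixes v :: "'a \<Rightarrow> int"
  assumes I: "finite I" "k \<in> I" and vk: "v k \<noteq> 0" and prim: "Gcd (v ` I) = 1" and r: "r > 0"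
    and big: "sqrt (\<Sum>i\<in>I. (real_of_int (v i))\<^sup>2) * (unit_ball_vol (card I - 1) * r ^ (card I - 1)) > 1"
  obtains w :: "'a \<Rightarrow> int"
  where "line_dist (\<lambda>i. of_int (v i)) I (\<lambda>i. of_int (w i)) \<le> 2 * r"
    and "\<And>c :: real. \<exists>i\<in>I. of_int (w i) \<noteq> c * of_int (v i)"
proof -
  define V where "V i = real_of_int (v i)" for i
  let ?T = "tube V I k r"
  have "emeasure (leb I) ?T = ennreal (sqrt (\<Sum>i\<in>I. (V i)\<^sup>2) * (unit_ball_vol (card I - 1) * r ^ (card I - 1)))"
    using emeasure_tube[of "I - {k}" k V r] I vk r by (simp add: insert_absorb V_def)
  also have "\<dots> > 1" using big by (simp add: V_def)
  finally have "emeasure (leb I) ?T > 1" .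
  then obtain x y and w :: "'a \<Rightarrow> int" where xy: "x \<in> ?T" "y \<in> ?T" "x \<noteq> y"
    and w: "\<And>i. i \<in> I \<Longrightarrow> x i - y i = of_int (w i)"
    using blichfeldt[OF I(1) sets_tube[OF I]] by metis
  show thesis
  proof (rule that[of w])
    have "line_dist V I (\<lambda>i. of_int (w i)) = line_dist V I (\<lambda>i. x i - y i)"
      using w by (intro line_dist_cong) simp
    also have "\<dots> \<le> line_dist V I x + line_dist V I y" by (rule line_dist_diff_le)
    also have "\<dots> \<le> 2 * r" using xy by (simp add: tube_def)
    finally show "line_dist (\<lambda>i. of_int (v i)) I (\<lambda>i. of_int (w i)) \<le> 2 * r"
      by (simp add: V_def[abs_def])
  next
    fix c :: real
    show "\<exists>i\<in>I. of_int (w i) \<noteq> c * of_int (v i)"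
    proof (rule ccontr)
      assume "\<not> ?thesis"
      then have c: "of_int (w i) = c * of_int (v i)" if "i \<in> I" for i using that by auto
      have "x k / V k - y k / V k = c"
        using w[OF I(2)] c[OF I(2)] vk by (simp add: V_def diff_divide_distrib[symmetric])
      then have "\<bar>c\<bar> < 1" using xy by (auto simp: tube_def)
      then have "c = 0" using primitive_multiple[OF prim I(2) vk c] by simp
      then have "x i = y i" if "i \<in> I" for i using w[OF that] c[OF that] by simp
      then have "x = y"
        using xy by (intro PiE_ext[of x I "\<lambda>_. UNIV" y]) (auto simp: tube_def space_PiM)
      with xy show False by simp
    qed
  qed
qed


section \<open>Loneliness\<close>

lemma dist_nearest_int_add_int: "dist_nearest_int (x + of_int m) = dist_nearest_int x"
proof -
  have "\<lfloor>x + of_int m + 1 / 2\<rfloor> = \<lfloor>x + 1 / 2\<rfloor> + m"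
    unfolding floor_add_int by (simp add: add_ac)
  then show ?thesis by (simp add: dist_nearest_int_def round_def)
qed

lemma dist_nearest_int_minus: "dist_nearest_int (- x) = dist_nearest_int x"
proof -
  have "dist_nearest_int (- y) \<le> dist_nearest_int y" for y
    using round_diff_minimal[of "- y" "- round y"] by (simp add: dist_nearest_int_def)
  from this[of x] this[of "- x"] show ?thesis by simp
qed

lemma dist_nearest_int_lipschitz: "dist_nearest_int x \<ge> dist_nearest_int y - \<bar>x - y\<bar>"
  using round_diff_minimal[of y "round x"] unfolding dist_nearest_int_def by linarith

lemma less_max_lonelinessE:
  assumes "m \<ge> 1" "c < max_loneliness m v"
  obtains t where "\<And>i. i \<in> {1..m} \<Longrightarrow> c < dist_nearest_int (t * v i)"
proof -
  obtain t where "c < Min ((\<lambda>i. dist_nearest_int (t * v i)) ` {1..m})"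
    using assms less_cSUP_iff[OF _ bdd_above_loneliness[OF assms(1)]]
    unfolding max_loneliness_def by auto
  then show thesis using assms(1) by (intro that[of t]) (subst (asm) Min_gr_iff, auto)
qed

lemma max_lonelinessI:
  assumes "m \<ge> 1" "\<And>i. i \<in> {1..m} \<Longrightarrow> c \<le> dist_nearest_int (t * v i)"
  shows "c \<le> max_loneliness m v"
  unfolding max_loneliness_def
proof (rule cSUP_upper2[OF bdd_above_loneliness[OF assms(1)]])
  show "c \<le> Min ((\<lambda>i. dist_nearest_int (t * v i)) ` {1..m})"
    using assms by (subst Min_ge_iff) auto
qed simp

text \<open>
Runners with opposite speeds are equally lonely at all times, so one of the two can be discarded.
\<close>

lemma repeated_speed:
  fixes x :: "nat \<Rightarrow> real"
  assumes LRC: "\<And>w :: nat \<Rightarrow> real. (\<And>i. i \<in> {1..n-1} \<Longrightarrow> w i \<noteq> 0) \<Longrightarrow> max_loneliness (n - 1) w \<ge> c"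
    and x: "\<And>i. i \<in> {1..n} \<Longrightarrow> x i \<noteq> 0"
    and ij: "i \<in> {1..n}" "j \<in> {1..n}" "i \<noteq> j" "\<bar>x i\<bar> = \<bar>x j\<bar>" and d: "d < c"
  obtains t where "\<And>l. l \<in> {1..n} \<Longrightarrow> d < dist_nearest_int (t * x l)"
proof -
  define w where "w l = x (if l < j then l else l + 1)" for l
  have "max_loneliness (n - 1) w \<ge> c"
  proof (rule LRC)
    fix l assume "l \<in> {1..n-1}"
    then show "w l \<noteq> 0" unfolding w_def using x by auto
  qed
  moreover have "n - 1 \<ge> 1" using ij by auto
  ultimately obtain t where t: "\<And>l. l \<in> {1..n-1} \<Longrightarrow> d < dist_nearest_int (t * w l)"
    using d less_max_lonelinessE[of "n - 1" d w] by auto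
  have *: "d < dist_nearest_int (t * x l)" if "l \<in> {1..n}" "l \<noteq> j" for l
  proof (cases "l < j")
    case True
    then show ?thesis using t[of l] that ij by (auto simp: w_def)
  next
    case False
    then have "l - 1 \<in> {1..n-1}" "w (l - 1) = x l" using that ij by (auto simp: w_def)
    then show ?thesis using t[of "l - 1"] by simp
  qed
  have "t * x j = t * x i \<or> t * x j = - (t * x i)" using ij(4) by (auto simp: abs_eq_iff)
  then have "dist_nearest_int (t * x j) = dist_nearest_int (t * x i)"
    by (auto simp: dist_nearest_int_minus)
  with * ij show thesis by (intro that[of t]) metis
qed

section \<open>From the plane back to the trajectory\<close>

text \<open>
The speeds \<open>\<bar>u l + c * v l\<bar> = \<bar>v l\<bar> \<bar>u l / v l + c\<bar>\<close> vanish at \<open>c = - u l / v l\<close>. Let \<open>p < q\<close> be the two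
smallest distinct values of \<open>u l / v l\<close>, attained at \<open>i\<close> and \<open>j\<close>. As \<open>- c\<close> runs from \<open>p\<close> to \<open>q\<close>, speed \<open>i\<close> grows from 0
while speed \<open>j\<close> falls to 0, so they agree somewhere strictly between. No ratio lies between \<open>p\<close> and
\<open>q\<close>, so all speeds are nonzero there.
\<close>

lemma plane_equal_speeds:
  fixes v u :: "'a \<Rightarrow> real"
  assumes I: "finite I" and v: "\<And>i. i \<in> I \<Longrightarrow> v i \<noteq> 0"
    and indep: "\<And>c. \<exists>i\<in>I. u i \<noteq> c * v i"
  obtains c i j where "\<And>l. l \<in> I \<Longrightarrow> u l + c * v l \<noteq> 0"
    and "i \<in> I" "j \<in> I" "i \<noteq> j" "\<bar>u i + c * v i\<bar> = \<bar>u j + c * v j\<bar>"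
proof -
  define \<rho> where "\<rho> i = u i / v i" for i
  have u: "u i + c * v i = v i * (\<rho> i + c)" if "i \<in> I" for i c
    using v[OF that] by (simp add: \<rho>_def field_simps)
  have ne: "I \<noteq> {}" using indep by blast
  define p where "p = Min (\<rho> ` I)"
  obtain i where i: "i \<in> I" "\<rho> i = p"
    using Min_in[of "\<rho> ` I"] I ne by (metis finite_imageI image_is_empty imageE p_def)
  have p: "p \<le> \<rho> l" if "l \<in> I" for l using I that by (simp add: p_def)
  define J where "J = {l \<in> I. \<rho> l \<noteq> p}"
  have "J \<noteq> {}"
    using indep[of p] v by (auto simp: J_def \<rho>_def field_simps)
  define q where "q = Min (\<rho> ` J)"
  have J: "finite J" using I by (simp add: J_def)
  obtain j where j: "j \<in> J" "\<rho> j = q"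
    using Min_in[of "\<rho> ` J"] J \<open>J \<noteq> {}\<close> by (metis finite_imageI image_is_empty imageE q_def)
  have q: "q \<le> \<rho> l" if "l \<in> I" "\<rho> l \<noteq> p" for l using J that by (simp add: q_def J_def)
  have pq: "p < q" and jI: "j \<in> I" using j p[of j] by (auto simp: J_def)
  define a b where "a = \<bar>v i\<bar>" and "b = \<bar>v j\<bar>"
  have ab: "a > 0" "b > 0" using v i jI by (auto simp: a_def b_def)
  define c where "c = - ((a * p + b * q) / (a + b))"
  have c: "p < - c" "- c < q" "a * (- c - p) = b * (q + c)"
    using ab pq unfolding c_def by (auto simp: field_simps)
  show thesis
  proof (rule that[of c i j])
    fix l assume l: "l \<in> I"
    then have "\<rho> l + c \<noteq> 0" using q[of l] c by (cases "\<rho> l = p") auto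
    then show "u l + c * v l \<noteq> 0" using u v l by simp
  next
    have "\<bar>\<rho> i + c\<bar> = - c - p" "\<bar>\<rho> j + c\<bar> = q + c" using i j c by auto
    then show "\<bar>u i + c * v i\<bar> = \<bar>u j + c * v j\<bar>"
      using c(3) by (simp add: u i(1) jI abs_mult a_def b_def)
  qed (use i j jI pq in auto)
qed

text \<open>
Rounding \<open>b\<close> to an integer \<open>m\<close> changes the point by at most \<open>\<bar>u\<bar> / 2\<close>, and
\<open>a v + m u = (a - m s) v + m w\<close> is congruent to a point of the line through \<open>v\<close>.
\<close>

lemma winding_line_approximates:
  fixes v w :: "'a \<Rightarrow> int" and s a b :: real
  defines "u \<equiv> \<lambda>i. of_int (w i) - s * of_int (v i)"
  obtains t where "\<And>i. dist_nearest_int (t * of_int (v i))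
    \<ge> dist_nearest_int (a * of_int (v i) + b * u i) - \<bar>u i\<bar> / 2"
proof (rule that)
  fix i
  define t where "t = a - of_int (round b) * s"
  have "dist_nearest_int (t * of_int (v i)) = dist_nearest_int (t * of_int (v i) + of_int (round b * w i))"
    by (rule dist_nearest_int_add_int[symmetric])
  also have "t * of_int (v i) + of_int (round b * w i) = a * of_int (v i) + of_int (round b) * u i"
    by (simp add: t_def u_def algebra_simps)
  also have "dist_nearest_int \<dots> \<ge> dist_nearest_int (a * of_int (v i) + b * u i)
      - \<bar>(a * of_int (v i) + of_int (round b) * u i) - (a * of_int (v i) + b * u i)\<bar>"
    by (rule dist_nearest_int_lipschitz)
  also have "(a * of_int (v i) + of_int (round b) * u i) - (a * of_int (v i) + b * u i)
      = (of_int (round b) - b) * u i"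
    by (simp add: algebra_simps)
  finally have "dist_nearest_int (t * of_int (v i))
      \<ge> dist_nearest_int (a * of_int (v i) + b * u i) - \<bar>(of_int (round b) - b) * u i\<bar>" .
  moreover have "\<bar>(of_int (round b) - b) * u i\<bar> \<le> 1 / 2 * \<bar>u i\<bar>"
    unfolding abs_mult by (intro mult_right_mono of_int_round_abs_le) auto
  ultimately show "dist_nearest_int ((a - of_int (round b) * s) * of_int (v i))
      \<ge> dist_nearest_int (a * of_int (v i) + b * u i) - \<bar>u i\<bar> / 2"
    by (simp add: t_def)
qed

text \<open>
Here \<open>u\<close> is the component orthogonal to \<open>v\<close> of a near return. As \<open>max_loneliness\<close> is a supremum,
the loneliness \<open>c\<close> of the auxiliary runners is only reached up to some \<open>e > 0\<close>, which is
harmless because the conclusion is about a supremum as well.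
\<close>

lemma loneliness_of_long_velocity:
  fixes v :: "nat \<Rightarrow> int"
  assumes n: "n \<ge> 2"
    and LRC: "\<And>w :: nat \<Rightarrow> real. (\<And>i. i \<in> {1..n-1} \<Longrightarrow> w i \<noteq> 0) \<Longrightarrow> max_loneliness (n - 1) w \<ge> c"
    and v: "\<And>i. i \<in> {1..n} \<Longrightarrow> v i \<noteq> 0" and prim: "Gcd (v ` {1..n}) = 1" and r: "r > 0"
    and big: "sqrt (\<Sum>i=1..n. (real_of_int (v i))\<^sup>2) * (unit_ball_vol (real n - 1) * r ^ (n - 1)) > 1"
  shows "max_loneliness n (\<lambda>i. real_of_int (v i)) \<ge> c - r"
proof -
  let ?I = "{1..n}" and ?v = "\<lambda>i. real_of_int (v i)"
  obtain w :: "nat \<Rightarrow> int" where w: "line_dist ?v ?I (\<lambda>i. of_int (w i)) \<le> 2 * r"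
    and indep: "\<And>c :: real. \<exists>i\<in>?I. of_int (w i) \<noteq> c * of_int (v i)"
    by (rule close_lattice_point[of ?I 1 v r]) (use n v prim r big in \<open>auto simp: of_nat_diff\<close>)
  define s where "s = (\<Sum>j\<in>?I. ?v j * of_int (w j)) / (\<Sum>j\<in>?I. (?v j)\<^sup>2)"
  define u where "u i = of_int (w i) - s * ?v i" for i
  have u_le: "\<bar>u i\<bar> \<le> 2 * r" if "i \<in> ?I" for i
  proof -
    have "\<bar>u i\<bar> \<le> L2_set (\<lambda>i. \<bar>u i\<bar>) ?I" by (rule member_le_L2_set) (use that in auto)
    also have "\<dots> = line_dist ?v ?I (\<lambda>i. of_int (w i))"
      by (simp add: line_dist_def u_def s_def L2_set_def)
    finally show ?thesis using w by simp
  qed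
  have "\<exists>i\<in>?I. u i \<noteq> d * ?v i" for d
    using indep[of "s + d"] by (simp add: u_def algebra_simps)
  from plane_equal_speeds[of ?I ?v u, OF _ _ this] v obtain d i j where x: "\<And>l. l \<in> ?I \<Longrightarrow> u l + d * ?v l \<noteq> 0"
    and ij: "i \<in> ?I" "j \<in> ?I" "i \<noteq> j" "\<bar>u i + d * ?v i\<bar> = \<bar>u j + d * ?v j\<bar>"
    by (metis finite_atLeastAtMost of_int_0_eq_iff)
  show ?thesis
  proof (rule field_le_epsilon)
    fix e :: real assume e: "e > 0"
    from e have ce: "c - e < c" by simp
    obtain t where t: "\<And>l. l \<in> ?I \<Longrightarrow> c - e < dist_nearest_int (t * (u l + d * ?v l))"
      using repeated_speed[of n c "\<lambda>l. u l + d * ?v l", OF LRC x ij ce] by blast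
    obtain t' where t': "\<And>i. dist_nearest_int (t' * ?v i)
        \<ge> dist_nearest_int (t * d * ?v i + t * u i) - \<bar>u i\<bar> / 2"
      using winding_line_approximates[of "t * d" v t w s] unfolding u_def by blast
    have "c - r - e \<le> max_loneliness n ?v"
    proof (rule max_lonelinessI)
      fix l assume l: "l \<in> ?I"
      have "t * d * ?v l + t * u l = t * (u l + d * ?v l)" by (simp add: algebra_simps)
      then show "c - r - e \<le> dist_nearest_int (t' * ?v l)"
        using t[OF l] t'[of l] u_le[OF l] by simp
    qed (use n in auto)
    then show "c - r \<le> max_loneliness n ?v + e" by simp
  qed
qed

section \<open>The size of the threshold, and the theorem\<close>

lemma Gamma_half_le: "Gamma ((real n + 1) / 2) \<le> real n powr (real n / 2)" if "n \<ge> 1"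
  using that
proof (induction n rule: less_induct)
  case (less n)
  consider "n = 1" | "n = 2" | "n \<ge> 3" using less.prems by linarith
  then show ?case
  proof cases
    case 1
    then show ?thesis by simp
  next
    case 2
    have "(1 / 2 :: real) \<notin> \<int>\<^sub>\<le>\<^sub>0"
      by (auto elim!: nonpos_Ints_cases simp: field_simps)
    then have "Gamma (3 / 2 :: real) = sqrt pi / 2"
      using Gamma_plus1[of "1/2::real"] by (simp add: Gamma_one_half_real)
    moreover have "sqrt pi < sqrt 4" using pi_less_4 by (simp only: real_sqrt_less_iff)
    ultimately show ?thesis using 2 by simp
  next
    case 3
    define m where "m = n - 2"
    have m: "m \<ge> 1" "m < n" "n = m + 2" using 3 by (auto simp: m_def)
    have "Gamma ((real n + 1) / 2) = Gamma ((real m + 1) / 2 + 1)"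
      using m by (intro arg_cong[of _ _ Gamma]) (simp add: field_simps)
    also have "\<dots> = (real m + 1) / 2 * Gamma ((real m + 1) / 2)"
      by (intro Gamma_plus1) (auto elim!: nonpos_Ints_cases simp: field_simps)
    also have "\<dots> \<le> real n * (real n powr (real m / 2))"
    proof (rule mult_mono)
      have "Gamma ((real m + 1) / 2) \<le> real m powr (real m / 2)" using less.IH m by blast
      also have "\<dots> \<le> real n powr (real m / 2)" using m by (intro powr_mono2) auto
      finally show "Gamma ((real m + 1) / 2) \<le> real n powr (real m / 2)" .
    qed (use m in \<open>auto intro!: Gamma_real_nonneg\<close>)
    also have "\<dots> = real n powr (1 + real m / 2)"
      using m by (simp add: powr_add)
    also have "1 + real m / 2 = real n / 2" using m by simp
    finally show ?thesis .
  qed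
qed

text \<open>
Besides the bound on the Gamma function, this uses \<open>(n + 1)\<^bsup>n - 1\<^esup> \<le> exp 1 * n\<^bsup>n - 1\<^esup>\<close> and
\<open>exp 1 < 4 \<le> n\<^sup>2\<close>.
\<close>

lemma threshold_less:
  assumes n: "n \<ge> 2"
  shows "Gamma ((real n + 1) / 2) * (real n * (real n + 1)) ^ (n - 1) / pi powr ((real n - 1) / 2)
          < real n powr (5 / 2 * real n)"
proof -
  define G where "G = Gamma ((real n + 1) / 2)"
  have G: "G > 0" "G \<le> real n powr (real n / 2)"
    using n Gamma_half_le[of n] by (auto simp: G_def intro!: Gamma_real_pos)
  have pi1: "pi powr ((real n - 1) / 2) \<ge> 1"
    using n pi_ge_two by (intro ge_one_powr_ge_zero) auto
  have "(real n + 1) ^ (n - 1) = (1 + 1 / real n) ^ (n - 1) * real n ^ (n - 1)"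
    using n by (simp add: power_mult_distrib[symmetric] field_simps)
  also have "\<dots> < real n ^ 2 * real n ^ (n - 1)"
  proof (intro mult_strict_right_mono)
    have "(1 + 1 / real n) ^ (n - 1) \<le> (1 + 1 / real n) ^ n"
      by (intro power_increasing) auto
    also have "\<dots> \<le> exp 1"
      using exp_ge_one_plus_x_over_n_power_n[of n 1] n by simp
    also have "\<dots> \<le> 3" by (rule exp_le)
    also have "\<dots> < 2 ^ 2" by simp
    also have "\<dots> \<le> real n ^ 2" using n by (intro power_mono) auto
    finally show "(1 + 1 / real n) ^ (n - 1) < real n ^ 2" .
  qed (use n in auto)
  finally have "(real n + 1) ^ (n - 1) < real n ^ 2 * real n ^ (n - 1)" .
  then have "(real n * (real n + 1)) ^ (n - 1) < real n ^ (n - 1) * (real n ^ 2 * real n ^ (n - 1))"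
    using n by (simp add: power_mult_distrib)
  also have "\<dots> = real n ^ ((n - 1) + (2 + (n - 1)))" by (simp only: power_add)
  also have "(n - 1) + (2 + (n - 1)) = 2 * n" using n by simp
  also have "real n ^ (2 * n) = real n powr (2 * real n)"
    using n by (subst powr_realpow[symmetric]) auto
  finally have P: "(real n * (real n + 1)) ^ (n - 1) < real n powr (2 * real n)" .
  have "G * (real n * (real n + 1)) ^ (n - 1) / pi powr ((real n - 1) / 2)
      \<le> G * (real n * (real n + 1)) ^ (n - 1) / 1"
    using G pi1 by (intro divide_left_mono) auto
  also have "\<dots> < real n powr (real n / 2) * real n powr (2 * real n)"
    using G P n by (simp, intro mult_le_less_imp_less) auto
  also have "\<dots> = real n powr (5 / 2 * real n)"
    by (simp add: powr_add[symmetric] algebra_simps)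
  finally show ?thesis by (simp add: G_def)
qed

theorem mainTheorem3:
  fixes n :: nat
  assumes "n \<ge> 2"
  shows "((\<forall>w :: nat \<Rightarrow> real. (\<forall>i\<in>{1..n-1}. w i \<noteq> 0) \<longrightarrow> max_loneliness (n - 1) w \<ge> 1 / real n)
          \<longrightarrow> (\<forall>v :: nat \<Rightarrow> int.
                (\<forall>i\<in>{1..n}. v i \<noteq> 0) \<and> Gcd (v ` {1..n}) = 1 \<and>
                sqrt (\<Sum>i=1..n. (real_of_int (v i))\<^sup>2)
                  > Gamma ((real n + 1) / 2) * (real n * (real n + 1)) ^ (n - 1)
                      / pi powr ((real n - 1) / 2)
                \<longrightarrow> max_loneliness n (\<lambda>i. real_of_int (v i)) \<ge> 1 / (real n + 1)))
       \<and> Gamma ((real n + 1) / 2) * (real n * (real n + 1)) ^ (n - 1)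
            / pi powr ((real n - 1) / 2)
          < real n powr (5 / 2 * real n)"
proof (intro conjI impI allI; (elim conjE)?)
  fix v :: "nat \<Rightarrow> int"
  assume LRC: "\<forall>w :: nat \<Rightarrow> real. (\<forall>i\<in>{1..n-1}. w i \<noteq> 0) \<longrightarrow> max_loneliness (n - 1) w \<ge> 1 / real n"
    and v: "\<forall>i\<in>{1..n}. v i \<noteq> 0" "Gcd (v ` {1..n}) = 1"
    and big: "sqrt (\<Sum>i=1..n. (real_of_int (v i))\<^sup>2)
                > Gamma ((real n + 1) / 2) * (real n * (real n + 1)) ^ (n - 1) / pi powr ((real n - 1) / 2)"
  define r where "r = 1 / (real n * (real n + 1))"
  have r: "r > 0" using assms by (simp add: r_def)
  have G: "Gamma ((real n + 1) / 2) > 0" by (intro Gamma_real_pos) auto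
  define B where "B = Gamma ((real n + 1) / 2) * (real n * (real n + 1)) ^ (n - 1) / pi powr ((real n - 1) / 2)"
  have B: "B > 0" using G assms by (simp add: B_def)
  have half: "(real n - 1) / 2 + 1 = (real n + 1) / 2" by (simp add: field_simps)
  have vol: "unit_ball_vol (real n - 1) * r ^ (n - 1) = 1 / B"
    unfolding B_def unit_ball_vol_def r_def half power_one_over by simp
  have "sqrt (\<Sum>i=1..n. (real_of_int (v i))\<^sup>2) * (unit_ball_vol (real n - 1) * r ^ (n - 1)) > 1"
    unfolding vol using big[folded B_def] B by simp
  then have "1 / real n - r \<le> max_loneliness n (\<lambda>i. real_of_int (v i))"
    using LRC v r assms by (intro loneliness_of_long_velocity) auto
  also have "1 / real n - r = 1 / (real n + 1)"
  proof -
    have "real n \<noteq> 0" "real n + 1 \<noteq> 0" using assms by auto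
    then show ?thesis by (simp add: r_def divide_simps)
  qed
  finally show "1 / (real n + 1) \<le> max_loneliness n (\<lambda>i. real_of_int (v i))" .
qed (rule threshold_less[OF assms])

end
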